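(* Let $G$ be a finite non-abelian group of order $p^2q$, where $p$ and $q$ are primes with $p<q$, such that the converse of Lagrange's theorem is not true for $G$. Then $G$ is isomorphic to $A_4$.
   Context: The converse of Lagrange's theorem is true for a finite group $G$ if for every positive divisor $d$ of $|G|$ the group $G$ has a subgroup of order $d$; it is not true for $G$ if there is a positive divisor $d$ of $|G|$ such that $G$ has no subgroup of order $d$. $A_4$ is the alternating group on four symbols. *)

theory Defs
  imports "HOL-Algebra.Sym_Groups" "HOL-Computational_Algebra.Primes"
begin

definition converse_lagrange :: "('a, 'b) monoid_scheme \<Rightarrow> bool"
  where "converse_lagrange G \<longleftrightarrow>
    (\<forall>d. 0 < d \<and> d dvd order G \<longrightarrow> (\<exists>H. subgroup H G \<and> card H = d))"

end

theory Submission
  imports Defs "HOL-Algebra.Zassenhaus" "HOL-Algebra.Sylow"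
begin

text \<open>
  The only order that Sylow's theorem leaves open is \<open>p q\<close>. Let \<open>Q\<close> have order \<open>q\<close>. If \<open>Q\<close> were
  not its own normalizer, it would be normalized by a subgroup \<open>K\<close> of order \<open>p\<close>, and \<open>Q K\<close> would
  have order \<open>p q\<close>. So \<open>Q\<close> is self-normalizing, and every double coset \<open>Q g Q\<close> with \<open>g \<notin> Q\<close> has
  \<open>q\<^sup>2\<close> elements; hence \<open>q\<close> divides \<open>p\<^sup>2 - 1\<close>, which forces \<open>p = 2\<close> and \<open>q = 3\<close>. The action on the
  four cosets of \<open>Q\<close> embeds \<open>G\<close> into \<open>S\<^sub>4\<close>, and an odd permutation in the image would make the
  even ones a subgroup of order 6, i.e. of order \<open>p q\<close>.
\<close>

section \<open>Subgroups of prime order and products of subgroups\<close>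

lemma (in group) card_subgroup_dvd:
  assumes "subgroup H G" "subgroup K G" "K \<subseteq> H"
  shows "card K dvd card H"
proof -
  interpret H: group "G\<lparr>carrier := H\<rparr>"
    using assms(1) by (rule subgroup_imp_group)
  have "subgroup K (G\<lparr>carrier := H\<rparr>)"
    using assms by (simp add: subgroup_incl)
  from H.lagrange[OF this, symmetric] show ?thesis
    by (simp add: order_def)
qed

lemma (in group) subgroup_of_prime_order:
  assumes "subgroup Q G" "Factorial_Ring.prime (card Q)" "subgroup K G" "K \<subseteq> Q"
  shows "K = {\<one>} \<or> K = Q"
proof -
  have fin: "finite Q"
    using assms(2) by (metis card.infinite not_prime_0)
  have "card K dvd card Q"
    using card_subgroup_dvd assms by blast
  then have "card K = 1 \<or> card K = card Q"
    using assms(2) prime_nat_iff by blast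
  then show ?thesis
  proof
    assume "card K = 1"
    then show ?thesis
      using subgroup.one_closed[OF assms(3)] by (metis card_1_singletonE singletonD)
  next
    assume "card K = card Q"
    then show ?thesis
      using card_subset_eq[OF fin assms(4)] by blast
  qed
qed

lemma (in group) inv_mult_cancel:
  assumes "x \<in> carrier G" "z \<in> carrier G"
  shows "inv x \<otimes> (x \<otimes> z) = z" "x \<otimes> (inv x \<otimes> z) = z"
  using assms by (simp_all flip: m_assoc)

text \<open>Two factorizations of one element differ by some \<open>k \<in> K\<close> whose
  conjugate by \<open>g\<close> lies in \<open>H\<close>, and \<open>triv\<close> forces that
  \<open>k\<close> to be \<one>. The case \<open>g = \<one>\<close> counts products of subgroups;
  the case \<open>H = K\<close> counts double cosets.\<close>

lemma (in group) inj_on_double_coset: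
  assumes H: "subgroup H G" and K: "subgroup K G" and g: "g \<in> carrier G"
    and triv: "\<And>k. k \<in> K \<Longrightarrow> g \<otimes> k \<otimes> inv g \<in> H \<Longrightarrow> k = \<one>"
  shows "inj_on (\<lambda>(h, k). h \<otimes> g \<otimes> k) (H \<times> K)"
proof (rule inj_onI, clarify)
  fix h k h' k'
  assume mem: "h \<in> H" "k \<in> K" "h' \<in> H" "k' \<in> K" and eq: "h \<otimes> g \<otimes> k = h' \<otimes> g \<otimes> k'"
  have hc: "h \<in> carrier G" "h' \<in> carrier G" "k \<in> carrier G" "k' \<in> carrier G"
    using mem subgroup.mem_carrier[OF H] subgroup.mem_carrier[OF K] by simp_all
  have "inv h' \<otimes> h = inv h' \<otimes> (h \<otimes> g \<otimes> k) \<otimes> inv k \<otimes> inv g"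
    using hc g by (simp add: m_assoc inv_mult_cancel)
  also have "\<dots> = g \<otimes> (k' \<otimes> inv k) \<otimes> inv g"
    unfolding eq using hc g by (simp add: m_assoc inv_mult_cancel)
  finally have *: "inv h' \<otimes> h = g \<otimes> (k' \<otimes> inv k) \<otimes> inv g" .
  have "inv h' \<otimes> h \<in> H" "k' \<otimes> inv k \<in> K"
    using mem H K by (auto intro: subgroup.m_closed subgroup.m_inv_closed)
  with * triv have "k' \<otimes> inv k = \<one>" by metis
  then have k: "k = k'"
    using hc by (metis inv_closed inv_equality inv_inv)
  then have "h = h'"
    using eq hc g by simp
  with k show "h = h' \<and> k = k'" by simp
qed

lemma (in group) card_set_mult:
  assumes H: "subgroup H G" and K: "subgroup K G" and "H \<inter> K = {\<one>}"
  shows "card (H <#> K) = card H * card K"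
proof -
  have "inj_on (\<lambda>(h, k). h \<otimes> \<one> \<otimes> k) (H \<times> K)"
    using assms subgroup.mem_carrier[OF K] by (intro inj_on_double_coset) auto
  moreover have "(\<lambda>(h, k). h \<otimes> \<one> \<otimes> k) ` (H \<times> K) = H <#> K"
    using subgroup.mem_carrier[OF H] by (force simp: set_mult_def)
  ultimately show ?thesis
    by (metis card_cartesian_product card_image)
qed

section \<open>Normalizers and double cosets of a subgroup of prime order\<close>

lemma (in group) normalizer_iff:
  assumes "H \<subseteq> carrier G"
  shows "g \<in> normalizer G H \<longleftrightarrow> g \<in> carrier G \<and> g <# H #> inv g = H"
  using assms by (auto simp: normalizer_def stabilizer_def)

lemma (in group) subset_normalizer:
  assumes "subgroup H G"
  shows "H \<subseteq> normalizer G H"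
  using subgroup_in_normalizer[OF assms] normal_imp_subgroup subgroup.subset by fastforce

lemma (in group) normal_imp_normalizer:
  assumes "H \<lhd> G"
  shows "normalizer G H = carrier G"
proof -
  have "subgroup H G" using assms normal_imp_subgroup by blast
  then have sub: "H \<subseteq> carrier G" by (rule subgroup.subset)
  have "g <# H #> inv g = H" if g: "g \<in> carrier G" for g
  proof -
    have "g <# H = H #> g" using normal.coset_eq[OF assms] g by simp
    then show ?thesis using sub g by (simp add: coset_mult_assoc)
  qed
  then show ?thesis using normalizer_iff[OF sub] by blast
qed

text \<open>The elements of \<open>Q\<close> that conjugation by \<open>g\<close> keeps in
  \<open>Q\<close> form a subgroup, and a nontrivial subgroup of a group of prime order is
  everything. Read contrapositively, this supplies the triviality condition for double cosets
  \<open>Q g Q\<close> with \<open>g\<close> outside the normalizer.\<close>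

lemma (in group) normalizer_prime_order:
  assumes Q: "subgroup Q G" and prime: "Factorial_Ring.prime (card Q)"
    and g: "g \<in> carrier G" and k: "k \<in> Q" "g \<otimes> k \<otimes> inv g \<in> Q" "k \<noteq> \<one>"
  shows "g \<in> normalizer G Q"
proof -
  define S where "S = {k \<in> Q. g \<otimes> k \<otimes> inv g \<in> Q}"
  note mem = subgroup.mem_carrier[OF Q]
  have "subgroup S G"
  proof (rule subgroupI)
    show "S \<subseteq> carrier G" "S \<noteq> {}" using mem k by (auto simp: S_def)
  next
    fix a assume a: "a \<in> S"
    then have "g \<otimes> inv a \<otimes> inv g = inv (g \<otimes> a \<otimes> inv g)"
      using g mem by (simp add: S_def inv_mult_group m_assoc)
    with a show "inv a \<in> S"
      using Q by (simp add: S_def subgroup.m_inv_closed)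
  next
    fix a b assume ab: "a \<in> S" "b \<in> S"
    have "inv g \<otimes> (g \<otimes> (b \<otimes> inv g)) = b \<otimes> inv g"
      using ab g mem by (simp add: S_def inv_mult_cancel)
    then have "g \<otimes> (a \<otimes> b) \<otimes> inv g = (g \<otimes> a \<otimes> inv g) \<otimes> (g \<otimes> b \<otimes> inv g)"
      using ab g mem by (simp add: S_def m_assoc)
    with ab show "a \<otimes> b \<in> S"
      using Q by (simp add: S_def subgroup.m_closed)
  qed
  moreover have "S \<noteq> {\<one>}" "S \<subseteq> Q"
    using k by (auto simp: S_def)
  ultimately have "S = Q"
    using subgroup_of_prime_order[OF Q prime] by blast
  then have sub: "g <# Q #> inv g \<subseteq> Q"
    by (auto simp: S_def l_coset_def r_coset_def)
  \<comment> \<open>Conjugation is injective and \<open>Q\<close> is finite, so the inclusion just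
    obtained is an equality.\<close>
  have "g <# Q #> inv g = (\<lambda>x. g \<otimes> x \<otimes> inv g) ` Q"
    by (auto simp: l_coset_def r_coset_def)
  moreover have "inj_on (\<lambda>x. g \<otimes> x \<otimes> inv g) Q"
    using g mem by (auto intro!: inj_onI)
  ultimately have "card (g <# Q #> inv g) = card Q"
    by (simp add: card_image)
  moreover have "finite Q"
    using prime by (metis card.infinite not_prime_0)
  ultimately have "g <# Q #> inv g = Q"
    using sub by (simp add: card_subset_eq)
  then show ?thesis
    using normalizer_iff[OF subgroup.subset[OF Q]] g by blast
qed

text \<open>The complement of \<open>Q\<close> is a disjoint union of double cosets
  \<open>Q x Q\<close>. Since no such \<open>x\<close> normalizes \<open>Q\<close>, each of them has
  exactly \<open>(card Q)^2\<close> elements.\<close>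

lemma (in group) self_normalizing_prime_order_dvd:
  assumes fin: "finite (carrier G)" and Q: "subgroup Q G" and prime: "Factorial_Ring.prime (card Q)"
    and self: "normalizer G Q = Q"
  shows "(card Q)\<^sup>2 dvd order G - card Q"
proof -
  define A where "A = carrier G - Q"
  define r where "r = {(x, y). x \<in> A \<and> y \<in> A \<and> (\<exists>a\<in>Q. \<exists>b\<in>Q. y = a \<otimes> x \<otimes> b)}"
  note mem = subgroup.mem_carrier[OF Q]
  note cl = subgroup.m_closed[OF Q] subgroup.m_inv_closed[OF Q] subgroup.one_closed[OF Q]
  \<comment> \<open>The complement is stable under multiplication by \<open>Q\<close> on both sides,
    so a class of \<open>r\<close> is a full double coset and not just a part of one.\<close>
  have inA: "a \<otimes> x \<otimes> b \<in> A" if "x \<in> A" "a \<in> Q" "b \<in> Q" for a x b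
  proof -
    have "x = inv a \<otimes> (a \<otimes> x \<otimes> b) \<otimes> inv b"
      using that mem by (simp add: A_def m_assoc inv_mult_cancel)
    then have "a \<otimes> x \<otimes> b \<notin> Q"
      using that cl by (metis A_def DiffD2)
    then show ?thesis using that mem by (simp add: A_def)
  qed
  have "equiv A r"
  proof (rule equivI)
    show "r \<subseteq> A \<times> A" by (auto simp: r_def)
    show "refl_on A r"
    proof (rule refl_onI)
      fix x assume x: "x \<in> A"
      then have "x = \<one> \<otimes> x \<otimes> \<one>" by (simp add: A_def)
      with x cl show "(x, x) \<in> r" unfolding r_def by blast
    qed
    show "sym r"
    proof (rule symI)
      fix x y assume "(x, y) \<in> r"
      then obtain a b where *: "x \<in> A" "y \<in> A" "a \<in> Q" "b \<in> Q" "y = a \<otimes> x \<otimes> b"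
        unfolding r_def by blast
      then have "x = inv a \<otimes> y \<otimes> inv b"
        using mem by (simp add: A_def m_assoc inv_mult_cancel)
      with * cl show "(y, x) \<in> r" unfolding r_def by blast
    qed
    show "trans r"
    proof (rule transI)
      fix x y z assume "(x, y) \<in> r" "(y, z) \<in> r"
      then obtain a b c d where *: "x \<in> A" "z \<in> A" "a \<in> Q" "b \<in> Q" "c \<in> Q" "d \<in> Q"
          "z = c \<otimes> (a \<otimes> x \<otimes> b) \<otimes> d"
        unfolding r_def by blast
      then have "z = (c \<otimes> a) \<otimes> x \<otimes> (b \<otimes> d)"
        using mem by (simp add: A_def m_assoc)
      with * cl show "(x, z) \<in> r" unfolding r_def by blast
    qed
  qed
  moreover have "(card Q)\<^sup>2 dvd card X" if X: "X \<in> A // r" for X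
  proof -
    obtain x where x: "x \<in> A" "X = r `` {x}"
      using X by (rule quotientE)
    have "X = (\<lambda>(a, b). a \<otimes> x \<otimes> b) ` (Q \<times> Q)"
      using x inA by (auto simp: r_def)
    moreover have "x \<in> carrier G" "x \<notin> normalizer G Q"
      using x(1) self by (auto simp: A_def)
    then have "inj_on (\<lambda>(a, b). a \<otimes> x \<otimes> b) (Q \<times> Q)"
      using normalizer_prime_order[OF Q prime] by (intro inj_on_double_coset[OF Q Q]) auto
    ultimately have "card X = card Q * card Q"
      by (simp add: card_image card_cartesian_product)
    then show ?thesis by (simp add: power2_eq_square)
  qed
  ultimately have "(card Q)\<^sup>2 dvd card A"
    using fin by (intro equiv_imp_dvd_card[of A r]) (auto simp: A_def)
  moreover have "card A = order G - card Q"
    using fin subgroup.subset[OF Q] finite_subset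
    by (auto simp: A_def order_def intro!: card_Diff_subset)
  ultimately show ?thesis by simp
qed

section \<open>The action on cosets and the parity of its permutations\<close>

text \<open>\<open>G\<close> permutes the right cosets of \<open>H\<close>, numbered from 1 to
  \<open>n\<close> by \<open>f\<close>. An element acting trivially fixes the coset \<open>H\<close>
  itself, hence lies in \<open>H\<close>.\<close>

lemma (in group) coset_action:
  assumes fin: "finite (carrier G)" and H: "subgroup H G" and n: "card (rcosets H) = n"
  obtains \<phi> where "group_hom G (sym_group n) \<phi>" "kernel G (sym_group n) \<phi> \<subseteq> H"
proof -
  have sub: "H \<subseteq> carrier G" using H by (rule subgroup.subset)
  have "finite (rcosets H)"
    using fin rcosets_subset_PowG[OF H] finite_subset by blast
  then obtain f where f: "bij_betw f {1..n} (rcosets H)"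
    using ex_bij_betw_nat_finite_1 n by blast
  define f' where "f' = inv_into {1..n} f"
  have ff': "f (f' X) = X" "f' X \<in> {1..n}" if "X \<in> rcosets H" for X
    unfolding f'_def
    using bij_betw_inv_into_right[OF f that] bij_betwE[OF bij_betw_inv_into[OF f]] that
    by blast+
  have f'f: "f' (f i) = i" "f i \<in> rcosets H" if "i \<in> {1..n}" for i
    unfolding f'_def
    using bij_betw_inv_into_left[OF f that] bij_betwE[OF f] that by blast+
  have carr: "X \<subseteq> carrier G" if "X \<in> rcosets H" for X
    using that rcosets_subset_PowG[OF H] by blast
  have act: "X #> g \<in> rcosets H" if "X \<in> rcosets H" "g \<in> carrier G" for X g
    using that sub by (auto simp: RCOSETS_def coset_mult_assoc)
  \<comment> \<open>The inverse turns right multiplication into a left action, as composition in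
    \<open>sym_group\<close> demands; points outside \<open>{1..n}\<close> must stay fixed for
    \<open>permutes\<close>.\<close>
  define \<phi> where "\<phi> g i = (if i \<in> {1..n} then f' (f i #> inv g) else i)" for g i
  have range: "\<phi> g i \<in> {1..n}" if "i \<in> {1..n}" "g \<in> carrier G" for g i
    using that ff' f'f act by (simp add: \<phi>_def)
  have mult: "\<phi> (g \<otimes> h) = \<phi> g \<circ> \<phi> h" if gh: "g \<in> carrier G" "h \<in> carrier G" for g h
  proof
    fix i
    show "\<phi> (g \<otimes> h) i = (\<phi> g \<circ> \<phi> h) i"
    proof (cases "i \<in> {1..n}")
      case True
      then have "\<phi> g (\<phi> h i) = f' (f i #> inv h #> inv g)"
        using gh ff' f'f act range by (simp add: \<phi>_def)
      also have "\<dots> = \<phi> (g \<otimes> h) i"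
        using True gh carr f'f by (simp add: \<phi>_def coset_mult_assoc inv_mult_group)
      finally show ?thesis by simp
    qed (auto simp: \<phi>_def)
  qed
  have one: "\<phi> \<one> = id"
    using carr f'f by (auto simp: \<phi>_def)
  have "\<phi> g permutes {1..n}" if g: "g \<in> carrier G" for g
  proof -
    have "\<phi> g \<circ> \<phi> (inv g) = id" "\<phi> (inv g) \<circ> \<phi> g = id"
      using g by (simp_all flip: mult add: one)
    then have "bij (\<phi> g)" using o_bij by blast
    then show ?thesis
      by (auto simp: permutes_def bij_iff \<phi>_def)
  qed
  then have "\<phi> \<in> hom G (sym_group n)"
    using mult by (auto simp: hom_def sym_group_carrier sym_group_mult)
  then have hom: "group_hom G (sym_group n) \<phi>"
    by (simp add: group_hom.intro group_hom_axioms.intro is_group sym_group_is_group)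
  have "kernel G (sym_group n) \<phi> \<subseteq> H"
  proof
    fix g assume "g \<in> kernel G (sym_group n) \<phi>"
    then have g: "g \<in> carrier G" and id: "\<phi> g = id"
      by (auto simp: kernel_def sym_group_one)
    have Hc: "H \<in> rcosets H"
      using subgroup.subgroup_in_rcosets[OF H is_group] .
    have "f' (H #> inv g) = f' H"
      using fun_cong[OF id, of "f' H"] ff'[OF Hc] by (simp add: \<phi>_def)
    then have "H #> inv g = H"
      using ff'(1) act[OF Hc] Hc g by (metis inv_closed)
    then have "inv g \<in> H"
      using coset_join1 H g sub by blast
    then show "g \<in> H"
      using g subgroup.m_inv_closed[OF H] by force
  qed
  with hom that show ?thesis by blast
qed

text \<open>An odd image makes \<open>sign \<circ> \<phi>\<close> surjective onto a group of order
  2, so its kernel has index 2.\<close>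

lemma (in group) index_two_if_odd_image:
  assumes hom: "group_hom G (sym_group n) \<phi>" and odd: "\<exists>g\<in>carrier G. \<not> evenperm (\<phi> g)"
  obtains E where "subgroup E G" "2 * card E = order G"
proof -
  interpret \<phi>: group_hom G "sym_group n" \<phi> by (rule hom)
  interpret sgn: group_hom "sym_group n" sign_img sign by (rule sign_group_hom)
  have "sign \<circ> \<phi> \<in> hom G sign_img"
    using \<phi>.homh sgn.homh by (rule Group.hom_compose)
  then interpret s: group_hom G sign_img "sign \<circ> \<phi>"
    by (simp add: group_hom.intro group_hom_axioms.intro is_group sign_img_is_group)
  define E where "E = kernel G sign_img (sign \<circ> \<phi>)"
  have "(sign \<circ> \<phi>) ` carrier G = carrier sign_img"
  proof
    show "(sign \<circ> \<phi>) ` carrier G \<subseteq> carrier sign_img"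
      using s.hom_closed by blast
    obtain g where "g \<in> carrier G" "\<not> evenperm (\<phi> g)" using odd by blast
    then have "-1 \<in> (sign \<circ> \<phi>) ` carrier G"
      by (force simp: sign_def)
    moreover have "1 \<in> (sign \<circ> \<phi>) ` carrier G"
      using s.hom_one one_closed by (metis image_eqI monoid.select_convs(2) sign_img_def)
    ultimately show "carrier sign_img \<subseteq> (sign \<circ> \<phi>) ` carrier G"
      by (simp add: sign_img_def)
  qed
  from iso_same_card[OF s.FactGroup_iso[OF this]]
  have "card (rcosets E) = 2"
    by (simp add: E_def FactGroup_def sign_img_def)
  then have "2 * card E = order G"
    using lagrange[OF s.subgroup_kernel] by (simp add: E_def)
  with s.subgroup_kernel that show ?thesis unfolding E_def by blast
qed

section \<open>Arithmetic and subgroups in order p^2 q\<close>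

lemma (in group) self_normalizing_if_no_subgroup:
  assumes fin: "finite (carrier G)" and p: "Factorial_Ring.prime p" and "order G = p\<^sup>2 * q"
    and Q: "subgroup Q G" and card_Q: "card Q = q"
    and q: "Factorial_Ring.prime q" and "p \<noteq> q"
    and no: "\<nexists>H. subgroup H G \<and> card H = p * q"
  shows "normalizer G Q = Q"
proof -
  let ?N = "normalizer G Q"
  let ?GN = "G\<lparr>carrier := ?N\<rparr>"
  have N: "subgroup ?N G"
    using Q by (simp add: normalizer_imp_subgroup subgroup.subset)
  have QN: "Q \<subseteq> ?N" using Q by (rule subset_normalizer)
  interpret N: group ?GN using N by (rule subgroup_imp_group)
  have finN: "finite ?N"
    using N fin finite_subset subgroup.subset by blast
  obtain m where m: "card ?N = q * m"
    using card_subgroup_dvd[OF N Q QN] card_Q by (auto elim: dvdE)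
  have "card ?N dvd p\<^sup>2 * q"
    using card_subgroup_dvd[OF subgroup_self N subgroup.subset[OF N]] assms(3) by (simp add: order_def)
  then have "m dvd p\<^sup>2"
    using m q by (simp add: mult.commute)
  then obtain i where i: "m = p ^ i"
    using p divides_primepow_nat by blast
  show ?thesis
  proof (cases "i = 0")
    case True
    then show ?thesis
      using m i card_Q QN card_subset_eq[OF finN QN] by simp
  next
    case False
    then obtain j where "i = Suc j" by (cases i) auto
    \<comment> \<open>The index of \<open>Q\<close> in its normalizer is a positive power of
      \<open>p\<close>, so Sylow's theorem inside the normalizer gives a subgroup of order
      \<open>p\<close>.\<close>
    then have "order ?GN = p ^ 1 * (p ^ j * q)"
      using m i by (simp add: order_def mult_ac)
    then obtain K where K: "subgroup K ?GN" "card K = p"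
      using sylow_thm[OF p N.is_group] finN by fastforce
    have KG: "subgroup K G" using K(1) N incl_subgroup by blast
    \<comment> \<open>\<open>Q\<close> is normal in its normalizer, which makes the product with
      \<open>K\<close> a subgroup there.\<close>
    have "subgroup (Q <#>\<^bsub>?GN\<^esub> K) ?GN"
      using N.mult_norm_subgroup[OF subgroup_in_normalizer[OF Q] K(1)] .
    then have "subgroup (Q <#> K) G"
      using N incl_subgroup by (simp add: set_mult_def)
    moreover have "card (Q <#> K) = p * q"
    proof -
      have sub: "subgroup (Q \<inter> K) G" using Q KG by (rule subgroups_Inter_pair)
      have "Q \<inter> K \<noteq> Q"
      proof
        assume "Q \<inter> K = Q"
        then have "q dvd p"
          using card_subgroup_dvd[OF KG Q] card_Q K(2) by blast
        then show False
          using p q \<open>p \<noteq> q\<close> by (metis primes_dvd_imp_eq)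
      qed
      then have "Q \<inter> K = {\<one>}"
        using subgroup_of_prime_order[OF Q _ sub] q card_Q by blast
      then show ?thesis
        using card_set_mult[OF Q KG] card_Q K(2) by (simp add: mult.commute)
    qed
    ultimately show ?thesis using no by blast
  qed
qed

text \<open>A divisor of the order is \<open>p^i\<close> or \<open>p^i * q\<close> with
  \<open>i \<le> 2\<close>. Sylow's theorem yields the orders \<open>p^i\<close> and
  \<open>q\<close>, the whole group has order \<open>p^2 * q\<close>, and \<open>H\<close> fills the
  remaining gap.\<close>

lemma (in group) converse_lagrange_p2q:
  assumes fin: "finite (carrier G)" and p: "Factorial_Ring.prime p" and q: "Factorial_Ring.prime q"
    and ord: "order G = p\<^sup>2 * q" and H: "subgroup H G" "card H = p * q"
  shows "converse_lagrange G"
  unfolding converse_lagrange_def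
proof (intro allI impI)
  fix d assume "0 < d \<and> d dvd order G"
  then have "d dvd p\<^sup>2 * q" using ord by simp
  then obtain a b where d: "d = a * b" "a dvd p\<^sup>2" "b dvd q"
    using division_decomp by blast
  then obtain i where i: "a = p ^ i" "i \<le> 2"
    using p divides_primepow_nat by blast
  have b: "b = 1 \<or> b = q"
    using d(3) q prime_nat_iff by blast
  have "i = 0 \<or> i = 1 \<or> i = 2" using i by auto
  moreover have "\<exists>H. subgroup H G \<and> card H = a"
    unfolding i(1)
  proof (rule sylow_thm[OF p is_group _ fin])
    show "order G = p ^ i * (p ^ (2 - i) * q)"
      using i(2) ord by (simp flip: power_add mult.assoc)
  qed
  moreover have "\<exists>H. subgroup H G \<and> card H = q"
    using sylow_thm[OF q is_group _ fin, of 1 "p\<^sup>2"] ord by (simp add: mult.commute)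
  moreover have "\<exists>H. subgroup H G \<and> card H = p\<^sup>2 * q"
    using subgroup_self ord by (auto simp: order_def)
  ultimately show "\<exists>H. subgroup H G \<and> card H = d"
    using b d(1) i H by auto
qed

text \<open>As \<open>q\<close> exceeds \<open>p\<close>, it cannot divide the positive number
  \<open>p - 1\<close>, so it divides \<open>p + 1\<close> and equals it. Of two consecutive primes
  one is even.\<close>

lemma prime_dvd_square_minus_one:
  fixes p q :: nat
  assumes p: "Factorial_Ring.prime p" and q: "Factorial_Ring.prime q" and "p < q" and "q dvd p\<^sup>2 - 1"
  shows "p = 2 \<and> q = 3"
proof -
  have p2: "p \<ge> 2" using p prime_ge_2_nat by blast
  have "p\<^sup>2 - 1 = (p - 1) * (p + 1)"
    using p2 by (simp add: power2_eq_square algebra_simps)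
  then have "q dvd p - 1 \<or> q dvd p + 1"
    using assms by (metis prime_dvd_mult_iff)
  then have "q = p + 1"
  proof
    assume "q dvd p - 1"
    then show ?thesis using p2 \<open>p < q\<close> by (auto dest: dvd_imp_le)
  next
    assume "q dvd p + 1"
    then show ?thesis using \<open>p < q\<close> by (auto dest: dvd_imp_le)
  qed
  then have "even p \<or> even q" by auto
  then have "p = 2"
    using prime_odd_nat[OF p] prime_odd_nat[OF q] p2 \<open>p < q\<close> by linarith
  with \<open>q = p + 1\<close> show ?thesis by simp
qed

theorem theorem3p5:
  fixes G :: "('a, 'b) monoid_scheme" and p q :: nat
  assumes "group G"
    and "finite (carrier G)"
    and "\<not> comm_group G"
    and "Factorial_Ring.prime p" and "Factorial_Ring.prime q" and "p < q"
    and "order G = p\<^sup>2 * q"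
    and "\<not> converse_lagrange G"
  shows "G \<cong> alt_group 4"
proof -
  interpret group G by fact
  note fin = assms(2) and p = assms(4) and q = assms(5) and ord = assms(7)
  have no: "\<nexists>H. subgroup H G \<and> card H = p * q"
    using converse_lagrange_p2q[OF fin p q ord] assms(8) by blast
  obtain Q where Q: "subgroup Q G" and card_Q: "card Q = q"
    using sylow_thm[OF q is_group _ fin, of 1 "p\<^sup>2"] ord by (auto simp: mult.commute)
  have self: "normalizer G Q = Q"
    using self_normalizing_if_no_subgroup[OF fin p ord Q card_Q q _ no] assms(6) by simp
  have "q\<^sup>2 dvd p\<^sup>2 * q - q"
    using self_normalizing_prime_order_dvd[OF fin Q _ self] card_Q q ord by simp
  moreover have "p\<^sup>2 * q - q = q * (p\<^sup>2 - 1)"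
    by (simp add: diff_mult_distrib2 mult.commute)
  \<comment> \<open>One factor \<open>q\<close> cancels from \<open>q^2\<close> dividing
    \<open>q * (p^2 - 1)\<close>.\<close>
  ultimately have "q dvd p\<^sup>2 - 1"
    using q by (simp add: power2_eq_square)
  then have pq: "p = 2" "q = 3"
    using prime_dvd_square_minus_one[OF p q assms(6)] by auto
  have index: "card (rcosets\<^bsub>G\<^esub> Q) = 4"
    using lagrange[OF Q] card_Q ord pq by simp
  obtain \<phi> where \<phi>: "group_hom G (sym_group 4) \<phi>" and ker: "kernel G (sym_group 4) \<phi> \<subseteq> Q"
    using coset_action[OF fin Q index] .
  interpret \<phi>: group_hom G "sym_group 4" \<phi> by (rule \<phi>)
  \<comment> \<open>A kernel is normal, so equality would make the normalizer of \<open>Q\<close>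
    all of \<open>G\<close>, while \<open>Q\<close> has 3 elements and \<open>G\<close> has 12. As
    \<open>Q\<close> has prime order, the kernel is then trivial.\<close>
  have "kernel G (sym_group 4) \<phi> \<noteq> Q"
  proof
    assume "kernel G (sym_group 4) \<phi> = Q"
    then have "carrier G = Q"
      using normal_imp_normalizer[OF \<phi>.normal_kernel] self by simp
    then show False
      using ord card_Q pq by (simp add: order_def)
  qed
  then have "kernel G (sym_group 4) \<phi> = {\<one>\<^bsub>G\<^esub>}"
    using subgroup_of_prime_order[OF Q _ \<phi>.subgroup_kernel ker] card_Q q by blast
  then have inj: "inj_on \<phi> (carrier G)"
    by (rule \<phi>.trivial_ker_imp_inj)
  have even: "evenperm (\<phi> g)" if "g \<in> carrier G" for g
  proof (rule ccontr)
    assume "\<not> evenperm (\<phi> g)"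
    with that have "\<exists>g\<in>carrier G. \<not> evenperm (\<phi> g)" by blast
    then obtain E where "subgroup E G" "2 * card E = order G"
      by (rule index_two_if_odd_image[OF \<phi>])
    then show False using no ord pq by auto
  qed
  have sub: "\<phi> ` carrier G \<subseteq> carrier (alt_group 4)"
    using even \<phi>.hom_closed by (auto simp: alt_group_carrier sym_group_carrier)
  \<comment> \<open>Image and alternating group both have 12 elements, so the inclusion between them
    is an equality.\<close>
  have "card (carrier (alt_group 4)) = 12"
    using alt_group_card_carrier[of 4] by (simp add: fact_numeral)
  moreover have "card (\<phi> ` carrier G) = 12"
    using inj ord pq by (simp add: card_image order_def)
  ultimately have "\<phi> ` carrier G = carrier (alt_group 4)"
    using sub by (intro card_subset_eq) (auto intro: card_ge_0_finite)
  moreover have "\<phi> \<in> hom G (alt_group 4)"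
    using sub \<phi>.hom_mult by (auto simp: hom_def alt_group_mult sym_group_mult)
  ultimately have "\<phi> \<in> iso G (alt_group 4)"
    using inj by (simp add: iso_def bij_betw_def)
  then show ?thesis by (rule is_isoI)
qed

end
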